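(* The Hanoi Towers group $H^{(3)}$ on three pegs is contracting and is regularly branching over its commutator subgroup $[H^{(3)},H^{(3)}]$.
   Context: Let $X=\{0,\dots,k-1\}$ and let $X^*$ be the set of finite words over $X$, viewed as a $k$-regular rooted tree $\mathcal{T}$: the root is the empty word, level $n$ consists of the words of length $n$, and the children of a vertex $u$ are the vertices $ux$, $x\in X$. Every automorphism $g$ of $\mathcal{T}$ can be written uniquely as $g=\pi_g\,(g_0,g_1,\dots,g_{k-1})$, where $\pi_g$ is a permutation of $X$ (the root permutation of $g$) and $g_x$, $x \in X$, are automorphisms of $\mathcal{T}$ (the first level sections of $g$), determined by $g(xw)=\pi_g(x)\,g_x(w)$ for all $x\in X$, $w\in X^*$. For $0\le i<j\le k-1$ let $a_{(ij)}$ be the automorphism of $\mathcal{T}$ defined recursively by (fixing the empty word and) $$a_{(ij)}(iw)=jw,\qquad a_{(ij)}(jw)=iw,\qquad a_{(ij)}(xw)=x\,a_{(ij)}(w)\ \text{ for } x\notin\{i,j\},$$ for all $w\in X^*$. The Hanoi Towers group on $k$ pegs, $k\ge 3$, is $H^{(k)}=\langle a_{(ij)} \mid 0\le i<j\le k-1\rangle$, a group of automorphisms of $\mathcal{T}$. Thus $H^{(3)}=\langle a_{(01)},a_{(02)},a_{(12)}\rangle$ acts on the $3$-regular rooted tree. The lengths of elements of $H^{(3)}$ are taken with respect to the generating set $S=\{a_{(01)},a_{(02)},a_{(12)}\}$. Contracting: the length of each first level section $g_i$, $i=0,\dots,k-1$, of $g$ is (strictly) shorter than the length of $g$, for all sufficiently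 long elements $g$ of the group. Regularly branching: a group $G$ of automorphisms of $\mathcal{T}$ that is spherically transitive (i.e. transitive on every level of $\mathcal{T}$) is regularly branching over its subgroup $K$ if $K$ is a normal subgroup of finite index in $G$ such that $K\times\cdots\times K$ ($k$ factors) is a normal subgroup of finite index in $G$ that is geometrically contained in $K$. Here geometrically contained means that the $k$ factors act independently on the corresponding $k$ subtrees of $\mathcal{T}$ rooted at the vertices of the first level, i.e. $K\times\cdots\times K$ is identified with the set of automorphisms with trivial root permutation and first level sections $(g_0,\dots,g_{k-1})$, $g_x\in K$. *)

theory Defs
  imports "HOL-Algebra.Algebra"
begin

text \<open>
  The alphabet is \<open>X = {..<k}\<close>, and the vertices of the \<open>k\<close>-regular rooted tree are the words
  over \<open>X\<close>. A word is a list with its first letter at the head, so the root is \<open>[]\<close> and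
  the children of \<open>u\<close> are the words \<open>u @ [x]\<close>.
\<close>

definition words :: "nat \<Rightarrow> nat list set" where
  "words k = lists {..<k}"

definition is_child :: "nat \<Rightarrow> nat list \<Rightarrow> nat list \<Rightarrow> bool" where
  "is_child k u v \<longleftrightarrow> (\<exists>x<k. v = u @ [x])"

text \<open>
  As in \<open>HOL-Algebra.Bij\<close>, bijections of the vertex set are extensional functions, so
  that an automorphism is determined by its values on \<open>words k\<close>.
\<close>

definition tree_aut :: "nat \<Rightarrow> (nat list \<Rightarrow> nat list) set" where
  "tree_aut k = {g \<in> Bij (words k). g [] = [] \<and>
     (\<forall>u\<in>words k. \<forall>v\<in>words k. is_child k u v \<longleftrightarrow> is_child k (g u) (g v))}"

definition tree_group :: "nat \<Rightarrow> (nat list \<Rightarrow> nat list) monoid" where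
  "tree_group k = BijGroup (words k) \<lparr>carrier := tree_aut k\<rparr>"

text \<open>
  The root permutation and the first level sections are read off from
  \<open>g (x # w) = root_perm g x # tree_section k g x w\<close>; see \<open>tree_aut_decomp\<close> and
  \<open>tree_aut_decomp_unique\<close> below.
\<close>

definition root_perm :: "(nat list \<Rightarrow> nat list) \<Rightarrow> nat \<Rightarrow> nat" where
  "root_perm g x = hd (g [x])"

definition tree_section :: "nat \<Rightarrow> (nat list \<Rightarrow> nat list) \<Rightarrow> nat \<Rightarrow> nat list \<Rightarrow> nat list" where
  "tree_section k g x = (\<lambda>w\<in>words k. tl (g (x # w)))"

fun swap_first :: "nat \<Rightarrow> nat \<Rightarrow> nat list \<Rightarrow> nat list" where
  "swap_first i j [] = []"
| "swap_first i j (x # w) =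
     (if x = i then j # w else if x = j then i # w else x # swap_first i j w)"

definition hanoi_gen :: "nat \<Rightarrow> nat \<Rightarrow> nat \<Rightarrow> nat list \<Rightarrow> nat list" where
  "hanoi_gen k i j = (\<lambda>w\<in>words k. swap_first i j w)"

definition hanoi_gens :: "nat \<Rightarrow> (nat list \<Rightarrow> nat list) set" where
  "hanoi_gens k = {hanoi_gen k i j | i j. i < j \<and> j < k}"

definition hanoi_group :: "nat \<Rightarrow> (nat list \<Rightarrow> nat list) set" where
  "hanoi_group k = generate (tree_group k) (hanoi_gens k)"

definition word_value :: "('a, 'b) monoid_scheme \<Rightarrow> 'a list \<Rightarrow> 'a" where
  "word_value G ws = foldr (\<otimes>\<^bsub>G\<^esub>) ws \<one>\<^bsub>G\<^esub>"

text \<open>Only meaningful for \<open>g\<close> in \<open>generate G S\<close>; for other \<open>g\<close> the value is unspecified.\<close>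

definition word_length :: "('a, 'b) monoid_scheme \<Rightarrow> 'a set \<Rightarrow> 'a \<Rightarrow> nat" where
  "word_length G S g =
     (LEAST n. \<exists>ws. length ws = n \<and> set ws \<subseteq> S \<union> m_inv G ` S \<and> word_value G ws = g)"

text \<open>
  The length of a section refers to the same generating set, so it presupposes that the section
  lies in the group; this is made explicit.
\<close>

definition contracting :: "nat \<Rightarrow> (nat list \<Rightarrow> nat list) set \<Rightarrow> bool" where
  "contracting k S \<longleftrightarrow>
     (\<exists>N. \<forall>g\<in>generate (tree_group k) S. N \<le> word_length (tree_group k) S g \<longrightarrow>
        (\<forall>x<k. tree_section k g x \<in> generate (tree_group k) S \<and>
           word_length (tree_group k) S (tree_section k g x) < word_length (tree_group k) S g))"

definition spherically_transitive :: "nat \<Rightarrow> (nat list \<Rightarrow> nat list) set \<Rightarrow> bool" where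
  "spherically_transitive k G \<longleftrightarrow>
     (\<forall>u\<in>words k. \<forall>v\<in>words k. length u = length v \<longrightarrow> (\<exists>g\<in>G. g u = v))"

text \<open>The product of \<open>k\<close> copies of \<open>K\<close>, acting independently on the subtrees at the first level.\<close>

definition first_level_power ::
    "nat \<Rightarrow> (nat list \<Rightarrow> nat list) set \<Rightarrow> (nat list \<Rightarrow> nat list) set" where
  "first_level_power k K =
     {g \<in> tree_aut k. \<forall>x<k. root_perm g x = x \<and> tree_section k g x \<in> K}"

definition finite_index_normal ::
    "('a, 'b) monoid_scheme \<Rightarrow> 'a set \<Rightarrow> 'a set \<Rightarrow> bool" where
  "finite_index_normal T N G \<longleftrightarrow>
     N \<lhd> (T\<lparr>carrier := G\<rparr>) \<and> finite (rcosets\<^bsub>T\<lparr>carrier := G\<rparr>\<^esub> N)"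

definition regularly_branching ::
    "nat \<Rightarrow> (nat list \<Rightarrow> nat list) set \<Rightarrow> (nat list \<Rightarrow> nat list) set \<Rightarrow> bool" where
  "regularly_branching k G K \<longleftrightarrow>
     subgroup G (tree_group k) \<and> spherically_transitive k G \<and>
     finite_index_normal (tree_group k) K G \<and>
     finite_index_normal (tree_group k) (first_level_power k K) G \<and>
     first_level_power k K \<subseteq> K"

lemma words_Nil [simp]: "[] \<in> words k"
  by (simp add: words_def)

lemma words_Cons [simp]: "x # w \<in> words k \<longleftrightarrow> x < k \<and> w \<in> words k"
  by (simp add: words_def)

lemma words_append [simp]: "u @ v \<in> words k \<longleftrightarrow> u \<in> words k \<and> v \<in> words k"
  by (simp add: words_def)

lemma subgroup_tree_aut: "subgroup (tree_aut k) (BijGroup (words k))"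
proof (rule group.subgroupI[OF group_BijGroup])
  show "tree_aut k \<subseteq> carrier (BijGroup (words k))"
    by (auto simp: tree_aut_def BijGroup_def)
  have "(\<lambda>x\<in>words k. x) \<in> tree_aut k"
    by (auto simp: tree_aut_def id_Bij)
  then show "tree_aut k \<noteq> {}" by blast
next
  fix f assume f: "f \<in> tree_aut k"
  then have fB: "f \<in> Bij (words k)" by (simp add: tree_aut_def)
  then have bij: "bij_betw f (words k) (words k)" by (simp add: Bij_def)
  let ?i = "inv_into (words k) f"
  have mem: "?i u \<in> words k" and fi: "f (?i u) = u" if "u \<in> words k" for u
    using that fB bij by (auto simp: Bij_inv_into_mem bij_betw_inv_into_right)
  have "?i [] = []"
    using f bij by (metis (mono_tags, lifting) bij_betw_inv_into_left mem_Collect_eq tree_aut_def words_Nil)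
  moreover have "is_child k u v \<longleftrightarrow> is_child k (?i u) (?i v)"
    if "u \<in> words k" "v \<in> words k" for u v
  proof -
    have "is_child k (?i u) (?i v) \<longleftrightarrow> is_child k (f (?i u)) (f (?i v))"
      using f mem[OF that(1)] mem[OF that(2)] by (simp add: tree_aut_def)
    then show ?thesis by (simp only: fi[OF that(1)] fi[OF that(2)])
  qed
  ultimately show "inv\<^bsub>BijGroup (words k)\<^esub> f \<in> tree_aut k"
    using fB by (auto simp: tree_aut_def inv_BijGroup restrict_inv_into_Bij)
next
  fix f g assume f: "f \<in> tree_aut k" and g: "g \<in> tree_aut k"
  have fB: "f \<in> Bij (words k)" and gB: "g \<in> Bij (words k)"
    using f g by (simp_all add: tree_aut_def)
  have mem: "g u \<in> words k" if "u \<in> words k" for u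
    using gB that by (auto dest: Bij_imp_funcset)
  have "compose (words k) f g [] = []"
    using f g by (simp add: tree_aut_def compose_def)
  moreover have "is_child k u v \<longleftrightarrow> is_child k (compose (words k) f g u) (compose (words k) f g v)"
    if "u \<in> words k" "v \<in> words k" for u v
  proof -
    have "is_child k u v \<longleftrightarrow> is_child k (g u) (g v)"
      using g that unfolding tree_aut_def by blast
    also have "\<dots> \<longleftrightarrow> is_child k (f (g u)) (f (g v))"
      using f mem[OF that(1)] mem[OF that(2)] unfolding tree_aut_def by blast
    finally show ?thesis using that by (simp add: compose_def)
  qed
  ultimately show "f \<otimes>\<^bsub>BijGroup (words k)\<^esub> g \<in> tree_aut k"
    using compose_Bij[OF fB gB] fB gB by (simp add: tree_aut_def BijGroup_def)
qed

lemma group_tree_group: "group (tree_group k)"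
  unfolding tree_group_def
  by (rule subgroup.subgroup_is_group[OF subgroup_tree_aut group_BijGroup])

lemma tree_aut_words: "g \<in> tree_aut k \<Longrightarrow> u \<in> words k \<Longrightarrow> g u \<in> words k"
  by (auto simp: tree_aut_def dest: Bij_imp_funcset)

lemma tree_aut_child:
  "g \<in> tree_aut k \<Longrightarrow> u @ [x] \<in> words k \<Longrightarrow> \<exists>y<k. g (u @ [x]) = g u @ [y]"
proof -
  assume g: "g \<in> tree_aut k" and ux: "u @ [x] \<in> words k"
  have "is_child k u (u @ [x])" using ux by (simp add: is_child_def)
  moreover have "u \<in> words k" using ux by simp
  ultimately have "is_child k (g u) (g (u @ [x]))"
    using g ux unfolding tree_aut_def by blast
  then show ?thesis by (simp add: is_child_def)
qed

lemma length_tree_aut: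
  assumes "g \<in> tree_aut k" "u \<in> words k" shows "length (g u) = length u"
  using assms(2)
proof (induction u rule: rev_induct)
  case Nil
  then show ?case using assms(1) by (simp add: tree_aut_def)
next
  case (snoc x u)
  then show ?case using tree_aut_child[OF assms(1), of u x] by auto
qed

lemma tree_aut_decomp:
  assumes g: "g \<in> tree_aut k" and x: "x < k" and w: "w \<in> words k"
  shows "g (x # w) = root_perm g x # tree_section k g x w"
proof -
  have "g (x # w) \<noteq> [] \<and> hd (g (x # w)) = hd (g [x])"
    using w
  proof (induction w rule: rev_induct)
    case Nil
    then show ?case using length_tree_aut[OF g, of "[x]"] x by auto
  next
    case (snoc y w)
    then show ?case using tree_aut_child[OF g, of "x # w" y] x by auto
  qed
  then show ?thesis using w by (simp add: root_perm_def tree_section_def) (metis list.collapse)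
qed

lemma tree_aut_decomp_unique:
  assumes "\<And>x w. x < k \<Longrightarrow> w \<in> words k \<Longrightarrow> g (x # w) = p x # s x w"
    and "\<And>x. x < k \<Longrightarrow> s x \<in> tree_aut k" and "x < k"
  shows "root_perm g x = p x" and "tree_section k g x = s x"
proof -
  show "root_perm g x = p x" using assms by (simp add: root_perm_def)
  have "s x \<in> extensional (words k)"
    using assms(2,3) by (auto simp: tree_aut_def Bij_def)
  then show "tree_section k g x = s x"
    using assms(1,3) by (auto simp: tree_section_def restrict_def extensional_def)
qed

lemma swap_first_involution: "swap_first i j (swap_first i j w) = w"
  by (induction w) auto

lemma swap_first_words: "i < k \<Longrightarrow> j < k \<Longrightarrow> w \<in> words k \<Longrightarrow> swap_first i j w \<in> words k"
  by (induction w) auto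

lemma swap_first_child:
  "i < k \<Longrightarrow> j < k \<Longrightarrow> is_child k u v \<Longrightarrow> is_child k (swap_first i j u) (swap_first i j v)"
proof -
  have "x < k \<Longrightarrow> i < k \<Longrightarrow> j < k \<Longrightarrow> \<exists>y<k. swap_first i j (u @ [x]) = swap_first i j u @ [y]" for x
    by (induction u) auto
  then show "i < k \<Longrightarrow> j < k \<Longrightarrow> is_child k u v \<Longrightarrow> is_child k (swap_first i j u) (swap_first i j v)"
    by (auto simp: is_child_def)
qed

lemma hanoi_gen_in_tree_aut:
  assumes "i < k" "j < k"
  shows "hanoi_gen k i j \<in> tree_aut k"
proof -
  have "bij_betw (swap_first i j) (words k) (words k)"
    by (rule bij_betw_byWitness[where f' = "swap_first i j"])
      (auto simp: swap_first_involution swap_first_words assms)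
  then have "hanoi_gen k i j \<in> Bij (words k)"
    by (simp add: Bij_def hanoi_gen_def)
  moreover have "is_child k u v \<longleftrightarrow> is_child k (swap_first i j u) (swap_first i j v)" for u v
    using swap_first_child[OF assms] swap_first_involution by metis
  ultimately show ?thesis by (auto simp: tree_aut_def hanoi_gen_def)
qed

lemma hanoi_gens_in_carrier: "hanoi_gens k \<subseteq> carrier (tree_group k)"
  by (auto simp: hanoi_gens_def tree_group_def hanoi_gen_in_tree_aut)

end

theory Submission
  imports Defs
begin

text \<open>
  Write \<open>H\<close> for the Hanoi Towers group on three pegs, \<open>D\<close> for its commutator subgroup, and
  \<open>a = (01)(1,1,a)\<close>, \<open>b = (02)(1,b,1)\<close>, \<open>c = (12)(c,1,1)\<close> for its generators, which are involutions.

  Contraction. A letter of a word contributes at most one letter to the word that represents the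
  section at \<open>x\<close> (\<open>section_word\<close>). If every letter contributes, then every letter fixes \<open>x\<close>.
  Only one of the three generators fixes a given peg, so the word is a power of an involution and
  is not geodesic once its length is at least two. Hence sections of elements of length at least
  two are strictly shorter.

  Transitivity. The stabiliser of the first level vertex \<open>0\<close> in \<open>H\<close> maps onto \<open>H\<close> under the section
  at \<open>0\<close>, because the sections of \<open>bab\<close>, \<open>aba\<close> and \<open>c\<close> at \<open>0\<close> are \<open>a\<close>, \<open>b\<close> and \<open>c\<close>
  (\<open>hanoi_3_section_surj\<close>). By induction on the length, every word can be moved to a word of zeros.

  Branching. As \<open>H\<close> is generated by finitely many involutions, \<open>H/D\<close> is a finite elementary abelian
  2-group; so \<open>D\<close> has finite index and contains all squares of elements of \<open>H\<close>. A computation gives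
  \<open>([b,c],1,1) = (abac)\<^sup>2\<close>, \<open>([a,c],1,1) = (babc)\<^sup>2\<close> and \<open>([b,a],1,1) = (bcbcab)\<^sup>2\<close>, so these three
  elements lie in \<open>D\<close> (\<open>lift_at_hanoi_commutators\<close>). The set of \<open>u\<close> in \<open>H\<close> with \<open>(u,1,1)\<close> in \<open>D\<close> is
  a subgroup of \<open>H\<close>. It is normal in \<open>H\<close>, because any \<open>h\<close> in \<open>H\<close> is the section at \<open>0\<close> of an element
  of \<open>H\<close> that fixes the vertex \<open>0\<close>, and conjugation by that element turns \<open>u\<close> into
  its conjugate by \<open>h\<close>. The generators of \<open>H\<close> commute modulo this normal subgroup, which therefore
  contains \<open>D\<close> (\<open>lift_at_zero_mem_hanoi_commutator\<close>). Conjugating by \<open>a\<close> and \<open>b\<close> moves the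
  nontrivial coordinate, and so \<open>D \<times> D \<times> D\<close> is contained in \<open>D\<close>. Sections of
  elements of \<open>H\<close> lie in \<open>H\<close>, so \<open>D \<times> D \<times> D\<close> is normal in \<open>H\<close>. Its index is finite because the root
  permutation of an element and the cosets modulo \<open>D\<close> of its three sections determine its coset
  (\<open>finite_index_normal_first_level_power\<close>).
\<close>

section \<open>Groups generated by involutions\<close>

lemma (in group) subgroup_centralizer:
  assumes "z \<in> carrier G"
  shows "subgroup {x \<in> carrier G. x \<otimes> z = z \<otimes> x} G"
proof (rule subgroupI)
  fix x assume "x \<in> {x \<in> carrier G. x \<otimes> z = z \<otimes> x}"
  then have x: "x \<in> carrier G" "x \<otimes> z = z \<otimes> x" by auto
  have "z \<otimes> inv x = inv x \<otimes> (x \<otimes> z) \<otimes> inv x"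
    using x(1) assms by (simp flip: m_assoc)
  also have "\<dots> = inv x \<otimes> z"
    using x(1) assms by (simp add: x(2) m_assoc)
  finally have "z \<otimes> inv x = inv x \<otimes> z" .
  then show "inv x \<in> {x \<in> carrier G. x \<otimes> z = z \<otimes> x}" using x by auto
next
  fix x y assume "x \<in> {x \<in> carrier G. x \<otimes> z = z \<otimes> x}" "y \<in> {x \<in> carrier G. x \<otimes> z = z \<otimes> x}"
  then show "x \<otimes> y \<in> {x \<in> carrier G. x \<otimes> z = z \<otimes> x}"
    using assms by simp (metis m_assoc)
qed (use assms in \<open>auto intro!: exI[of _ \<one>]\<close>)

lemma (in group) comm_group_if_generators_commute:
  assumes S: "S \<subseteq> carrier G" and gen: "generate G S = carrier G"
    and comm: "\<And>x y. x \<in> S \<Longrightarrow> y \<in> S \<Longrightarrow> x \<otimes> y = y \<otimes> x"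
  shows "comm_group G"
proof (rule group_comm_groupI)
  have gen_comm: "x \<otimes> s = s \<otimes> x" if "s \<in> S" "x \<in> carrier G" for x s
    using generate_subgroup_incl[OF _ subgroup_centralizer, of S s] that S comm gen by blast
  \<comment> \<open>Every generator is central, so the centralizer of any \<open>y\<close> contains the generators.\<close>
  show "x \<otimes> y = y \<otimes> x" if "x \<in> carrier G" "y \<in> carrier G" for x y
  proof -
    have "S \<subseteq> {x \<in> carrier G. x \<otimes> y = y \<otimes> x}"
    proof
      fix s assume "s \<in> S"
      then show "s \<in> {x \<in> carrier G. x \<otimes> y = y \<otimes> x}"
        using S gen_comm[of s y] that by auto
    qed
    then show ?thesis
      using generate_subgroup_incl[OF _ subgroup_centralizer, of S y] that gen by blast
  qed
qed

lemma (in comm_group) square_eq_one_if_generated_by_involutions: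
  assumes S: "S \<subseteq> carrier G" and gen: "generate G S = carrier G"
    and invol: "\<And>s. s \<in> S \<Longrightarrow> s \<otimes> s = \<one>" and x: "x \<in> carrier G"
  shows "x \<otimes> x = \<one>"
proof -
  have "subgroup {x \<in> carrier G. x \<otimes> x = \<one>} G"
  proof (rule subgroupI)
    fix x assume "x \<in> {x \<in> carrier G. x \<otimes> x = \<one>}"
    then show "inv x \<in> {x \<in> carrier G. x \<otimes> x = \<one>}"
      using inv_equality by fastforce
  next
    fix x y assume xy: "x \<in> {x \<in> carrier G. x \<otimes> x = \<one>}" "y \<in> {x \<in> carrier G. x \<otimes> x = \<one>}"
    then have "x \<otimes> y \<otimes> (x \<otimes> y) = (x \<otimes> x) \<otimes> (y \<otimes> y)" by (simp add: m_ac)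
    then show "x \<otimes> y \<in> {x \<in> carrier G. x \<otimes> x = \<one>}" using xy by simp
  qed auto
  then show ?thesis
    using generate_subgroup_incl[of S "{x \<in> carrier G. x \<otimes> x = \<one>}"] S invol gen x by blast
qed

lemma (in comm_group) finite_if_generated_by_involutions:
  assumes S: "S \<subseteq> carrier G" "finite S" and gen: "generate G S = carrier G"
    and invol: "\<And>s. s \<in> S \<Longrightarrow> s \<otimes> s = \<one>"
  shows "finite (carrier G)"
proof -
  \<comment> \<open>Every element is the product of the elements of some subset of \<open>S\<close>: multiplying by \<open>s\<close>
    removes \<open>s\<close> from the subset or adds it.\<close>
  let ?P = "\<lambda>A. finprod G (\<lambda>s. s) A"
  have P: "?P A \<in> carrier G" if "A \<subseteq> S" for A
    using that S by (intro finprod_closed) auto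
  have mult: "s \<otimes> ?P A \<in> ?P ` Pow S" if "s \<in> S" "A \<subseteq> S" for s A
  proof (cases "s \<in> A")
    case True
    have fin: "finite (A - {s})" using that S(2) finite_subset by blast
    have "?P A = ?P (insert s (A - {s}))" using True by (simp add: insert_absorb)
    also have "\<dots> = s \<otimes> ?P (A - {s})"
      using that S fin by (intro finprod_insert) auto
    finally have "s \<otimes> ?P A = (s \<otimes> s) \<otimes> ?P (A - {s})"
      using that S P[of "A - {s}"] by (simp add: m_assoc subset_iff)
    then have "s \<otimes> ?P A = ?P (A - {s})" using that invol P[of "A - {s}"] by (simp add: subset_iff)
    then show ?thesis using that by blast
  next
    case False
    have "?P (insert s A) = s \<otimes> ?P A"
      using that S False finite_subset by (intro finprod_insert) auto
    then show ?thesis using that by (metis PowI image_eqI insert_subset)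
  qed
  have "x \<otimes> ?P A \<in> ?P ` Pow S" if "x \<in> generate G S" "A \<subseteq> S" for x A
    using that
  proof (induction arbitrary: A)
    case one then show ?case using P by auto
  next
    case (incl h) then show ?case using mult by blast
  next
    case (inv h)
    then have "inv h = h" using invol S inv_equality by auto
    then show ?case using mult inv by auto
  next
    case (eng h1 h2)
    obtain B where B: "B \<subseteq> S" "h2 \<otimes> ?P A = ?P B" using eng.IH(2)[OF eng.prems] by auto
    have "h1 \<in> carrier G" "h2 \<in> carrier G" using eng.hyps gen by auto
    then have "h1 \<otimes> h2 \<otimes> ?P A = h1 \<otimes> ?P B"
      by (simp only: m_assoc P[OF eng.prems] B(2))
    then show ?case using eng.IH(1)[OF B(1)] by simp
  qed
  from this[of _ "{}"] have "carrier G \<subseteq> ?P ` Pow S"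
    using gen by auto
  then show ?thesis using S(2) finite_subset by blast
qed

lemma (in normal) generate_factor_group:
  assumes "S \<subseteq> carrier G" "generate G S = carrier G"
  shows "generate (G Mod H) ((#>) H ` S) = carrier (G Mod H)"
proof -
  interpret q: group_hom G "G Mod H" "(#>) H"
    by (simp add: group_hom_def group_hom_axioms_def factorgroup_is_group r_coset_hom_Mod)
  show ?thesis
    using q.generate_img[OF assms(1)] assms(2) by (auto simp: FactGroup_def RCOSETS_def)
qed

lemma (in normal) derived_subset_if_generators_commute:
  assumes S: "S \<subseteq> carrier G" and gen: "generate G S = carrier G"
    and comm: "\<And>x y. x \<in> S \<Longrightarrow> y \<in> S \<Longrightarrow> x \<otimes> y \<otimes> inv x \<otimes> inv y \<in> H"
  shows "derived G (carrier G) \<subseteq> H"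
proof -
  interpret Q: group "G Mod H" by (rule factorgroup_is_group)
  have "comm_group (G Mod H)"
  proof (rule Q.comm_group_if_generators_commute[OF _ generate_factor_group[OF S gen]])
    show "(#>) H ` S \<subseteq> carrier (G Mod H)" using S by (auto simp: FactGroup_def RCOSETS_def)
    fix A B assume "A \<in> (#>) H ` S" "B \<in> (#>) H ` S"
    then obtain x y where xy: "x \<in> S" "y \<in> S" "A = H #> x" "B = H #> y" by auto
    then have c: "x \<in> carrier G" "y \<in> carrier G" using S by auto
    have "(x \<otimes> y) \<otimes> inv (y \<otimes> x) \<in> H"
      using comm[OF xy(1,2)] c by (simp add: inv_mult_group m_assoc)
    then have "x \<otimes> y \<in> H #> (y \<otimes> x)"
      using rcos_module_rev[OF is_group] c by simp
    then have "H #> (x \<otimes> y) = H #> (y \<otimes> x)"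
      using c repr_independence[OF _ _ subgroup_axioms] by (metis m_closed)
    then show "A \<otimes>\<^bsub>G Mod H\<^esub> B = B \<otimes>\<^bsub>G Mod H\<^esub> A"
      using xy c by (simp add: rcos_sum)
  qed
  then show ?thesis using derived_minimal normal_axioms by blast
qed

lemma (in group)
  assumes S: "S \<subseteq> carrier G" and gen: "generate G S = carrier G"
    and invol: "\<And>s. s \<in> S \<Longrightarrow> s \<otimes> s = \<one>"
  shows square_mem_derived: "g \<in> carrier G \<Longrightarrow> g \<otimes> g \<in> derived G (carrier G)"
    and finite_rcosets_derived: "finite S \<Longrightarrow> finite (rcosets (derived G (carrier G)))"
proof -
  let ?D = "derived G (carrier G)"
  interpret D: normal ?D G by (rule derived_self_is_normal)
  interpret Q: comm_group "G Mod ?D" by (rule derived_quot_is_comm_group)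
  have Q: "(#>) ?D ` S \<subseteq> carrier (G Mod ?D)" using S by (auto simp: FactGroup_def RCOSETS_def)
  have one: "\<one>\<^bsub>G Mod ?D\<^esub> = ?D" by (simp add: FactGroup_def)
  have invQ: "A \<otimes>\<^bsub>G Mod ?D\<^esub> A = \<one>\<^bsub>G Mod ?D\<^esub>" if "A \<in> (#>) ?D ` S" for A
    using that S invol by (auto simp: D.rcos_sum subset_iff one D.subset)
  show "g \<otimes> g \<in> ?D" if g: "g \<in> carrier G"
  proof -
    have "(?D #> g) \<otimes>\<^bsub>G Mod ?D\<^esub> (?D #> g) = \<one>\<^bsub>G Mod ?D\<^esub>"
      by (rule Q.square_eq_one_if_generated_by_involutions[OF Q D.generate_factor_group[OF S gen] invQ])
        (use g in \<open>auto simp: FactGroup_def RCOSETS_def\<close>)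
    then have "?D #> (g \<otimes> g) = ?D" using g by (simp add: D.rcos_sum one)
    then show ?thesis using g rcos_self[OF _ D.subgroup_axioms, of "g \<otimes> g"] by simp
  qed
  show "finite (rcosets ?D)" if "finite S"
    using Q.finite_if_generated_by_involutions[OF Q _ D.generate_factor_group[OF S gen] invQ] that
    by (simp add: FactGroup_def)
qed

section \<open>Words in the generators of a group\<close>

lemma word_value_Nil [simp]: "word_value G [] = \<one>\<^bsub>G\<^esub>"
  by (simp add: word_value_def)

lemma word_value_Cons [simp]: "word_value G (s # ws) = s \<otimes>\<^bsub>G\<^esub> word_value G ws"
  by (simp add: word_value_def)

lemma (in group) word_value_closed: "set ws \<subseteq> carrier G \<Longrightarrow> word_value G ws \<in> carrier G"
  by (induction ws) auto

lemma (in group) word_value_append: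
  "set us \<subseteq> carrier G \<Longrightarrow> set vs \<subseteq> carrier G \<Longrightarrow>
    word_value G (us @ vs) = word_value G us \<otimes> word_value G vs"
  by (induction us) (auto simp: word_value_closed m_assoc)

lemma (in group) word_value_mem_generate:
  "set ws \<subseteq> S \<union> m_inv G ` S \<Longrightarrow> word_value G ws \<in> generate G S"
  by (induction ws) (auto intro: generate.intros)

lemma (in group) ex_word_value:
  assumes "S \<subseteq> carrier G" "g \<in> generate G S"
  shows "\<exists>ws. set ws \<subseteq> S \<union> m_inv G ` S \<and> word_value G ws = g"
  using assms(2)
proof induction
  case one
  show ?case by (rule exI[of _ "[]"]) simp
next
  case (incl h)
  then show ?case using assms(1) by (intro exI[of _ "[h]"]) auto
next
  case (inv h)
  then show ?case using assms(1) by (intro exI[of _ "[inv h]"]) auto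
next
  case (eng g h)
  then obtain us vs where
    "set us \<subseteq> S \<union> m_inv G ` S" "word_value G us = g"
    "set vs \<subseteq> S \<union> m_inv G ` S" "word_value G vs = h" by blast
  moreover have "S \<union> m_inv G ` S \<subseteq> carrier G" using assms(1) by auto
  ultimately show ?case
    by (intro exI[of _ "us @ vs"]) (auto simp: word_value_append[OF order_trans order_trans])
qed

lemma (in group) ex_geodesic_word:
  assumes "S \<subseteq> carrier G" "g \<in> generate G S"
  obtains ws where "set ws \<subseteq> S \<union> m_inv G ` S" "word_value G ws = g"
    "length ws = word_length G S g"
  using LeastI_ex[of "\<lambda>n. \<exists>ws. length ws = n \<and> set ws \<subseteq> S \<union> m_inv G ` S \<and> word_value G ws = g"]
    ex_word_value[OF assms] unfolding word_length_def by blast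

lemma word_length_le:
  "set ws \<subseteq> S \<union> m_inv G ` S \<Longrightarrow> word_length G S (word_value G ws) \<le> length ws"
  unfolding word_length_def by (rule Least_le) blast

section \<open>Automorphisms of a regular rooted tree\<close>

interpretation tree: group "tree_group k" for k
  by (rule group_tree_group)

lemma carrier_tree_group [simp]: "carrier (tree_group k) = tree_aut k"
  by (simp add: tree_group_def)

lemma tree_mult_closed [simp]:
  "f \<in> tree_aut k \<Longrightarrow> g \<in> tree_aut k \<Longrightarrow> f \<otimes>\<^bsub>tree_group k\<^esub> g \<in> tree_aut k"
  using tree.m_closed by simp

lemma tree_inv_closed [simp]: "f \<in> tree_aut k \<Longrightarrow> inv\<^bsub>tree_group k\<^esub> f \<in> tree_aut k"
  using tree.inv_closed by simp

lemma tree_one_closed [simp]: "\<one>\<^bsub>tree_group k\<^esub> \<in> tree_aut k"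
  using tree.one_closed by simp

lemma tree_mult_apply [simp]:
  "f \<in> tree_aut k \<Longrightarrow> g \<in> tree_aut k \<Longrightarrow> u \<in> words k \<Longrightarrow> (f \<otimes>\<^bsub>tree_group k\<^esub> g) u = f (g u)"
  by (simp add: tree_group_def BijGroup_def tree_aut_def compose_def)

lemma tree_one_apply [simp]: "u \<in> words k \<Longrightarrow> \<one>\<^bsub>tree_group k\<^esub> u = u"
  by (simp add: tree_group_def BijGroup_def)

lemma tree_inv_apply [simp]:
  assumes "f \<in> tree_aut k" "u \<in> words k"
  shows "f ((inv\<^bsub>tree_group k\<^esub> f) u) = u" "(inv\<^bsub>tree_group k\<^esub> f) (f u) = u"
  using assms tree_mult_apply[of f k "inv\<^bsub>tree_group k\<^esub> f" u]
    tree_mult_apply[of "inv\<^bsub>tree_group k\<^esub> f" k f u] by (simp_all del: tree_mult_apply)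

lemma tree_aut_Nil [simp]: "f \<in> tree_aut k \<Longrightarrow> f [] = []"
  by (simp add: tree_aut_def)

lemma tree_aut_extensional: "f \<in> tree_aut k \<Longrightarrow> f \<in> extensional (words k)"
  unfolding tree_aut_def Bij_def by blast

lemma tree_aut_eqI:
  assumes "f \<in> tree_aut k" "g \<in> tree_aut k"
    and "\<And>x w. x < k \<Longrightarrow> w \<in> words k \<Longrightarrow> f (x # w) = g (x # w)"
  shows "f = g"
proof (rule extensionalityI)
  show "f \<in> extensional (words k)" "g \<in> extensional (words k)"
    using assms(1,2) by (simp_all add: tree_aut_extensional)
  show "f u = g u" if "u \<in> words k" for u
    using that assms by (cases u) auto
qed

text \<open>For a bijection \<open>f\<close> of the words that maps children to children and whose inverse \<open>g\<close> also maps children to children, adjacency is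
  preserved in both directions.\<close>

lemma tree_autI:
  assumes "f \<in> extensional (words k)" "f [] = []"
    and "\<And>u. u \<in> words k \<Longrightarrow> f u \<in> words k" "\<And>u. u \<in> words k \<Longrightarrow> g u \<in> words k"
    and "\<And>u. u \<in> words k \<Longrightarrow> g (f u) = u" "\<And>u. u \<in> words k \<Longrightarrow> f (g u) = u"
    and child_f: "\<And>u x. u @ [x] \<in> words k \<Longrightarrow> \<exists>y<k. f (u @ [x]) = f u @ [y]"
    and child_g: "\<And>u x. u @ [x] \<in> words k \<Longrightarrow> \<exists>y<k. g (u @ [x]) = g u @ [y]"
  shows "f \<in> tree_aut k"
proof -
  have "bij_betw f (words k) (words k)"
    by (rule bij_betw_byWitness[where f' = g]) (use assms in auto)
  then have "f \<in> Bij (words k)" using assms(1) by (simp add: Bij_def)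
  moreover have "is_child k u v \<longleftrightarrow> is_child k (f u) (f v)"
    if u: "u \<in> words k" and v: "v \<in> words k" for u v
  proof
    assume "is_child k u v"
    then show "is_child k (f u) (f v)"
      using v child_f[of u] unfolding is_child_def by blast
  next
    assume "is_child k (f u) (f v)"
    then have "is_child k (g (f u)) (g (f v))"
      using assms(3)[OF v] child_g[of "f u"] unfolding is_child_def by auto
    then show "is_child k u v" by (simp only: assms(5)[OF u] assms(5)[OF v])
  qed
  ultimately show ?thesis
    using assms(2) unfolding tree_aut_def by blast
qed

lemma root_perm_less: "g \<in> tree_aut k \<Longrightarrow> x < k \<Longrightarrow> root_perm g x < k"
  using tree_aut_words[of g k "[x]"] tree_aut_decomp[of g k x "[]"] by simp

lemma tree_section_words:
  "g \<in> tree_aut k \<Longrightarrow> x < k \<Longrightarrow> w \<in> words k \<Longrightarrow> tree_section k g x w \<in> words k"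
  using tree_aut_words[of g k "x # w"] tree_aut_decomp[of g k x w] by simp

lemma root_perm_inv:
  assumes g: "g \<in> tree_aut k" and x: "x < k"
  shows "root_perm (inv\<^bsub>tree_group k\<^esub> g) (root_perm g x) = x"
    and "w \<in> words k \<Longrightarrow>
      tree_section k (inv\<^bsub>tree_group k\<^esub> g) (root_perm g x) (tree_section k g x w) = w"
proof -
  have "root_perm (inv\<^bsub>tree_group k\<^esub> g) (root_perm g x) = x \<and>
    tree_section k (inv\<^bsub>tree_group k\<^esub> g) (root_perm g x) (tree_section k g x w) = w"
    if "w \<in> words k" for w
  proof -
    have "(inv\<^bsub>tree_group k\<^esub> g) (g (x # w)) = x # w" using g x that by simp
    then show ?thesis
      using g x that
      by (simp add: tree_aut_decomp[of g k] tree_aut_decomp[of "inv\<^bsub>tree_group k\<^esub> g" k]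
          root_perm_less tree_section_words)
  qed
  from this this[of "[]"] show "root_perm (inv\<^bsub>tree_group k\<^esub> g) (root_perm g x) = x"
    and "w \<in> words k \<Longrightarrow>
      tree_section k (inv\<^bsub>tree_group k\<^esub> g) (root_perm g x) (tree_section k g x w) = w"
    by auto
qed

lemma tree_section_child:
  assumes "g \<in> tree_aut k" "x < k" "u @ [y] \<in> words k"
  shows "\<exists>z<k. tree_section k g x (u @ [y]) = tree_section k g x u @ [z]"
  using tree_aut_child[of g k "x # u" y] assms tree_aut_decomp[of g k x "u @ [y]"]
    tree_aut_decomp[of g k x u] by auto

lemma tree_section_in_tree_aut:
  assumes g: "g \<in> tree_aut k" and x: "x < k"
  shows "tree_section k g x \<in> tree_aut k"
proof (rule tree_autI[where g = "tree_section k (inv\<^bsub>tree_group k\<^esub> g) (root_perm g x)"])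
  let ?h = "inv\<^bsub>tree_group k\<^esub> g"
  have h: "?h \<in> tree_aut k" using g by simp
  have gx: "root_perm g x < k" using root_perm_less g x by blast
  have inv: "inv\<^bsub>tree_group k\<^esub> ?h = g" using g by simp
  show "tree_section k g x \<in> extensional (words k)" by (simp add: tree_section_def)
  show "tree_section k g x [] = []"
    using length_tree_aut[of g k "[x]"] g x tree_aut_decomp[of g k x "[]"] by simp
  show "tree_section k g x u \<in> words k" if "u \<in> words k" for u
    using tree_section_words g x that by blast
  show "tree_section k ?h (root_perm g x) u \<in> words k" if "u \<in> words k" for u
    using tree_section_words[OF h gx that] .
  show "tree_section k ?h (root_perm g x) (tree_section k g x u) = u" if "u \<in> words k" for u
    using root_perm_inv(2)[OF g x that] .
  show "tree_section k g x (tree_section k ?h (root_perm g x) u) = u" if "u \<in> words k" for u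
    using root_perm_inv(2)[OF h gx that] unfolding inv root_perm_inv(1)[OF g x] .
  show "\<exists>z<k. tree_section k g x (u @ [y]) = tree_section k g x u @ [z]"
    if "u @ [y] \<in> words k" for u y using tree_section_child[OF g x that] .
  show "\<exists>z<k. tree_section k ?h (root_perm g x) (u @ [y]) =
      tree_section k ?h (root_perm g x) u @ [z]"
    if "u @ [y] \<in> words k" for u y using tree_section_child[OF h gx that] .
qed

lemma root_perm_section_eqI:
  assumes "s \<in> tree_aut k" "\<And>w. w \<in> words k \<Longrightarrow> g (x # w) = y # s w"
  shows "root_perm g x = y" "tree_section k g x = s"
proof -
  show "root_perm g x = y" using assms by (simp add: root_perm_def)
  have "s \<in> extensional (words k)" using assms(1) by (rule tree_aut_extensional)
  then show "tree_section k g x = s"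
    using assms(2) by (auto simp: tree_section_def restrict_def extensional_def)
qed

text \<open>The product \<open>f \<otimes> g\<close> applies \<open>g\<close> first, so the section of \<open>f\<close> is taken at the image of \<open>x\<close>
  under \<open>g\<close>.\<close>

lemma root_perm_section_mult:
  assumes f: "f \<in> tree_aut k" and g: "g \<in> tree_aut k" and x: "x < k"
  shows "root_perm (f \<otimes>\<^bsub>tree_group k\<^esub> g) x = root_perm f (root_perm g x)"
    and "tree_section k (f \<otimes>\<^bsub>tree_group k\<^esub> g) x =
      tree_section k f (root_perm g x) \<otimes>\<^bsub>tree_group k\<^esub> tree_section k g x"
proof -
  note less = root_perm_less[OF g x]
  note sec = tree_section_in_tree_aut[OF f less] tree_section_in_tree_aut[OF g x]
  have "(f \<otimes>\<^bsub>tree_group k\<^esub> g) (x # w) = root_perm f (root_perm g x) #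
      (tree_section k f (root_perm g x) \<otimes>\<^bsub>tree_group k\<^esub> tree_section k g x) w"
    if "w \<in> words k" for w
    using f g x that sec less tree_section_words[OF g x that]
    by (simp add: tree_aut_decomp[of g k] tree_aut_decomp[of f k])
  from root_perm_section_eqI[OF tree_mult_closed[OF sec], of "f \<otimes>\<^bsub>tree_group k\<^esub> g" x, OF this]
  show "root_perm (f \<otimes>\<^bsub>tree_group k\<^esub> g) x = root_perm f (root_perm g x)"
    "tree_section k (f \<otimes>\<^bsub>tree_group k\<^esub> g) x =
      tree_section k f (root_perm g x) \<otimes>\<^bsub>tree_group k\<^esub> tree_section k g x"
    by auto
qed

lemma root_perm_section_one:
  assumes "x < k"
  shows "root_perm \<one>\<^bsub>tree_group k\<^esub> x = x"
    and "tree_section k \<one>\<^bsub>tree_group k\<^esub> x = \<one>\<^bsub>tree_group k\<^esub>"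
  using root_perm_section_eqI[of "\<one>\<^bsub>tree_group k\<^esub>" k "\<one>\<^bsub>tree_group k\<^esub>" x x] assms by auto

lemma tree_section_inv:
  assumes g: "g \<in> tree_aut k" and x: "x < k"
  shows "tree_section k (inv\<^bsub>tree_group k\<^esub> g) (root_perm g x) =
    inv\<^bsub>tree_group k\<^esub> (tree_section k g x)"
proof -
  have "tree_section k (inv\<^bsub>tree_group k\<^esub> g) (root_perm g x) \<otimes>\<^bsub>tree_group k\<^esub> tree_section k g x =
      tree_section k (inv\<^bsub>tree_group k\<^esub> g \<otimes>\<^bsub>tree_group k\<^esub> g) x"
    using root_perm_section_mult(2)[OF tree_inv_closed[OF g] g x] by simp
  also have "\<dots> = \<one>\<^bsub>tree_group k\<^esub>" using g x by (simp add: root_perm_section_one)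
  finally show ?thesis
    by (rule tree.inv_equality[symmetric])
      (use g x in \<open>simp_all add: tree_section_in_tree_aut root_perm_less\<close>)
qed

text \<open>The automorphism that acts as \<open>u\<close> on the subtree at the first level vertex \<open>i\<close> and fixes
  every vertex outside that subtree.\<close>

definition lift_at :: "nat \<Rightarrow> nat \<Rightarrow> (nat list \<Rightarrow> nat list) \<Rightarrow> nat list \<Rightarrow> nat list" where
  "lift_at k i u =
     (\<lambda>w\<in>words k. case w of [] \<Rightarrow> [] | x # v \<Rightarrow> x # (if x = i then u v else v))"

lemma lift_at_Cons [simp]:
  "x < k \<Longrightarrow> w \<in> words k \<Longrightarrow> lift_at k i u (x # w) = x # (if x = i then u w else w)"
  by (simp add: lift_at_def)

lemma lift_at_Nil [simp]: "lift_at k i u [] = []"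
  by (simp add: lift_at_def)

lemma lift_at_child:
  assumes "u \<in> tree_aut k" "w @ [x] \<in> words k"
  shows "\<exists>y<k. lift_at k i u (w @ [x]) = lift_at k i u w @ [y]"
  using assms tree_aut_child[of u k "tl w" x] by (cases w) auto

lemma lift_at_in_tree_aut [simp]:
  assumes u: "u \<in> tree_aut k"
  shows "lift_at k i u \<in> tree_aut k"
proof (rule tree_autI[where g = "lift_at k i (inv\<^bsub>tree_group k\<^esub> u)"])
  have words: "lift_at k i v w \<in> words k" if "v \<in> tree_aut k" "w \<in> words k" for v w
    using that by (cases w) (auto simp: tree_aut_words)
  show "lift_at k i u w \<in> words k" "lift_at k i (inv\<^bsub>tree_group k\<^esub> u) w \<in> words k"
    if "w \<in> words k" for w using words u that by auto
  show "lift_at k i (inv\<^bsub>tree_group k\<^esub> u) (lift_at k i u w) = w"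
    "lift_at k i u (lift_at k i (inv\<^bsub>tree_group k\<^esub> u) w) = w" if "w \<in> words k" for w
    using u that by (cases w; simp add: tree_aut_words)+
  show "\<exists>y<k. lift_at k i u (w @ [x]) = lift_at k i u w @ [y]"
    "\<exists>y<k. lift_at k i (inv\<^bsub>tree_group k\<^esub> u) (w @ [x]) =
      lift_at k i (inv\<^bsub>tree_group k\<^esub> u) w @ [y]"
    if "w @ [x] \<in> words k" for w x
    using lift_at_child[OF u that] lift_at_child[OF tree_inv_closed[OF u] that] by auto
qed (auto simp: lift_at_def)

lemma lift_at_mult:
  assumes "u \<in> tree_aut k" "v \<in> tree_aut k"
  shows "lift_at k i (u \<otimes>\<^bsub>tree_group k\<^esub> v) = lift_at k i u \<otimes>\<^bsub>tree_group k\<^esub> lift_at k i v"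
  by (rule tree_aut_eqI[where k = k]) (use assms in \<open>auto simp: tree_aut_words\<close>)

lemma lift_at_one: "lift_at k i \<one>\<^bsub>tree_group k\<^esub> = \<one>\<^bsub>tree_group k\<^esub>"
  by (rule tree_aut_eqI[where k = k]) auto

lemma lift_at_inv:
  assumes "u \<in> tree_aut k"
  shows "lift_at k i (inv\<^bsub>tree_group k\<^esub> u) = inv\<^bsub>tree_group k\<^esub> (lift_at k i u)"
proof -
  have "lift_at k i (inv\<^bsub>tree_group k\<^esub> u) \<otimes>\<^bsub>tree_group k\<^esub> lift_at k i u = \<one>\<^bsub>tree_group k\<^esub>"
    using assms by (simp add: lift_at_mult[symmetric] lift_at_one)
  then show ?thesis
    by (rule tree.inv_equality[symmetric]) (use assms in simp_all)
qed

text \<open>Conjugation by \<open>g\<close> moves the support of \<open>lift_at k i u\<close> to the vertex \<open>g(i)\<close> and conjugates \<open>u\<close>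
  by the section of \<open>g\<close> at \<open>i\<close>.\<close>

lemma conj_lift_at:
  assumes g: "g \<in> tree_aut k" and u: "u \<in> tree_aut k" and i: "i < k"
  shows "g \<otimes>\<^bsub>tree_group k\<^esub> lift_at k i u \<otimes>\<^bsub>tree_group k\<^esub> inv\<^bsub>tree_group k\<^esub> g =
    lift_at k (root_perm g i)
      (tree_section k g i \<otimes>\<^bsub>tree_group k\<^esub> u \<otimes>\<^bsub>tree_group k\<^esub> inv\<^bsub>tree_group k\<^esub> (tree_section k g i))"
    (is "_ = lift_at k ?j ?v")
proof -
  have s: "tree_section k g i \<in> tree_aut k" using tree_section_in_tree_aut[OF g i] .
  have v: "?v \<in> tree_aut k" using s u by simp
  have "g \<otimes>\<^bsub>tree_group k\<^esub> lift_at k i u = lift_at k ?j ?v \<otimes>\<^bsub>tree_group k\<^esub> g"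
  proof (rule tree_aut_eqI[where k = k])
    fix x w assume xw: "x < k" "w \<in> words k"
    show "(g \<otimes>\<^bsub>tree_group k\<^esub> lift_at k i u) (x # w) =
      (lift_at k ?j ?v \<otimes>\<^bsub>tree_group k\<^esub> g) (x # w)"
    proof (cases "x = i")
      case True
      then show ?thesis
        using g u s v xw tree_aut_words[OF u xw(2)] tree_aut_words[OF s xw(2)]
        by (simp add: tree_aut_decomp[of g k] root_perm_less)
    next
      case False
      then have "root_perm g x \<noteq> ?j" using root_perm_inv(1)[OF g] xw(1) i by metis
      then show ?thesis
        using g u v xw False
        by (simp add: tree_aut_decomp[of g k] root_perm_less tree_section_words)
    qed
  qed (use g u v in auto)
  then show ?thesis using g v by (simp add: tree.m_assoc)
qed

section \<open>Powers of a normal subgroup on the first level\<close>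

lemma first_level_power_memD:
  assumes "g \<in> first_level_power k K"
  shows "g \<in> tree_aut k" "\<And>x. x < k \<Longrightarrow> root_perm g x = x" "\<And>x. x < k \<Longrightarrow> tree_section k g x \<in> K"
  using assms by (auto simp: first_level_power_def)

lemma subgroup_first_level_power:
  assumes K: "subgroup K (tree_group k)"
  shows "subgroup (first_level_power k K) (tree_group k)"
proof (rule tree.subgroupI)
  interpret K: subgroup K "tree_group k" by fact
  show "first_level_power k K \<subseteq> carrier (tree_group k)" by (auto simp: first_level_power_def)
  have "\<one>\<^bsub>tree_group k\<^esub> \<in> first_level_power k K"
    by (simp add: first_level_power_def root_perm_section_one)
  then show "first_level_power k K \<noteq> {}" by blast
  show "f \<otimes>\<^bsub>tree_group k\<^esub> g \<in> first_level_power k K"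
    if "f \<in> first_level_power k K" "g \<in> first_level_power k K" for f g
    using that[THEN first_level_power_memD(1)] that[THEN first_level_power_memD(2)]
      that[THEN first_level_power_memD(3)]
    by (simp add: first_level_power_def root_perm_section_mult)
  show "inv\<^bsub>tree_group k\<^esub> f \<in> first_level_power k K" if "f \<in> first_level_power k K" for f
  proof -
    note f = first_level_power_memD[OF that]
    have "root_perm (inv\<^bsub>tree_group k\<^esub> f) x = x \<and> tree_section k (inv\<^bsub>tree_group k\<^esub> f) x \<in> K"
      if "x < k" for x
      using root_perm_inv(1)[OF f(1) that] tree_section_inv[OF f(1) that] f(2,3)[OF that]
      by simp
    then show ?thesis using f(1) by (simp add: first_level_power_def)
  qed
qed

lemma finite_image_if_determined:
  assumes "finite (f ` A)" "\<And>x y. x \<in> A \<Longrightarrow> y \<in> A \<Longrightarrow> f x = f y \<Longrightarrow> g x = g y"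
  shows "finite (g ` A)"
proof -
  have "g ` A \<subseteq> (g \<circ> inv_into A f) ` (f ` A)"
  proof
    fix z assume "z \<in> g ` A"
    then obtain x where x: "x \<in> A" "z = g x" by blast
    then have "z = (g \<circ> inv_into A f) (f x)"
      using assms(2)[of x "inv_into A f (f x)"]
      by (simp add: inv_into_into f_inv_into_f)
    then show "z \<in> (g \<circ> inv_into A f) ` (f ` A)" using x(1) by blast
  qed
  then show ?thesis using assms(1) finite_subset by blast
qed

lemma finite_index_normal_first_level_power:
  assumes G: "subgroup G (tree_group k)"
    and self_similar: "\<And>g x. g \<in> G \<Longrightarrow> x < k \<Longrightarrow> tree_section k g x \<in> G"
    and K: "finite_index_normal (tree_group k) K G"
    and sub: "first_level_power k K \<subseteq> G"
  shows "finite_index_normal (tree_group k) (first_level_power k K) G"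
proof -
  let ?T = "tree_group k" and ?L = "first_level_power k K"
  let ?G = "?T\<lparr>carrier := G\<rparr>"
  have normal: "K \<lhd> ?G" and fin: "finite (rcosets\<^bsub>?G\<^esub> K)"
    using K by (simp_all add: finite_index_normal_def)
  interpret G: subgroup G ?T by (rule G)
  interpret GG: group ?G by (rule G.subgroup_is_group[OF tree.is_group])
  interpret N: normal K ?G by (rule normal)
  have KT: "subgroup K ?T"
    using tree.incl_subgroup[OF G N.subgroup_axioms] .
  have GT: "g \<in> tree_aut k" if "g \<in> G" for g using that G.subset by auto
  have inv_eq: "inv\<^bsub>?G\<^esub> g = inv\<^bsub>?T\<^esub> g" if "g \<in> G" for g
    using tree.m_inv_consistent[OF G that] .
  have conj_K: "g \<otimes>\<^bsub>?T\<^esub> h \<otimes>\<^bsub>?T\<^esub> inv\<^bsub>?T\<^esub> g \<in> K" if "g \<in> G" "h \<in> K" for g h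
    using N.inv_op_closed2[of g h] that inv_eq by simp
  have L: "subgroup ?L ?T" by (rule subgroup_first_level_power[OF KT])
  then have LG: "subgroup ?L ?G" using tree.subgroup_incl[OF L G sub] by simp
  have "?L \<lhd> ?G"
  proof (rule GG.normal_invI[OF LG])
    fix g h assume "g \<in> carrier ?G" and h: "h \<in> ?L"
    then have g: "g \<in> G" "g \<in> tree_aut k" using GT by auto
    note hD = first_level_power_memD[OF h]
    have "root_perm (g \<otimes>\<^bsub>?T\<^esub> h \<otimes>\<^bsub>?T\<^esub> inv\<^bsub>?T\<^esub> g) y = y \<and>
      tree_section k (g \<otimes>\<^bsub>?T\<^esub> h \<otimes>\<^bsub>?T\<^esub> inv\<^bsub>?T\<^esub> g) y \<in> K" if y: "y < k" for y
    proof -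
      define x where "x = root_perm (inv\<^bsub>?T\<^esub> g) y"
      have x: "x < k" unfolding x_def using root_perm_less y g by simp
      have gx: "root_perm g x = y"
        using root_perm_inv(1)[of "inv\<^bsub>?T\<^esub> g" k y] y g by (simp add: x_def)
      have "tree_section k (inv\<^bsub>?T\<^esub> g) y = inv\<^bsub>?T\<^esub> (tree_section k g x)"
        using tree_section_inv[OF g(2) x] gx by simp
      then show ?thesis
        using conj_K[OF self_similar[OF g(1) x] hD(3)[OF x]] g(2) hD(1) hD(2)[OF x] x y gx
        by (simp add: root_perm_section_mult x_def[symmetric])
    qed
    then have "g \<otimes>\<^bsub>?T\<^esub> h \<otimes>\<^bsub>?T\<^esub> inv\<^bsub>?T\<^esub> g \<in> ?L"
      using g hD(1) by (simp add: first_level_power_def)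
    then show "g \<otimes>\<^bsub>?G\<^esub> h \<otimes>\<^bsub>?G\<^esub> inv\<^bsub>?G\<^esub> g \<in> ?L" using inv_eq g by simp
  qed
  moreover have "finite (rcosets\<^bsub>?G\<^esub> ?L)"
  proof -
    \<comment> \<open>The coset of \<open>g\<close> is determined by the root permutation and the cosets of the sections.\<close>
    let ?f = "\<lambda>g. \<lambda>x\<in>{..<k}. (root_perm g x, K #>\<^bsub>?G\<^esub> tree_section k g x)"
    have "?f g \<in> {..<k} \<rightarrow>\<^sub>E {..<k} \<times> rcosets\<^bsub>?G\<^esub> K" if "g \<in> G" for g
    proof (rule PiE_I)
      fix x assume "x \<in> {..<k}"
      then show "?f g x \<in> {..<k} \<times> rcosets\<^bsub>?G\<^esub> K"
        using that GT self_similar GG.rcosetsI[OF N.subset, of "tree_section k g x"]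
        by (simp add: root_perm_less)
    qed simp
    then have "?f ` G \<subseteq> {..<k} \<rightarrow>\<^sub>E {..<k} \<times> rcosets\<^bsub>?G\<^esub> K" by blast
    then have "finite (?f ` G)"
      by (rule finite_subset) (simp add: finite_PiE fin)
    moreover have "?L #>\<^bsub>?G\<^esub> g = ?L #>\<^bsub>?G\<^esub> h"
      if g: "g \<in> G" and h: "h \<in> G" and eq: "?f g = ?f h" for g h
    proof -
      have perm: "root_perm g x = root_perm h x"
        and coset: "K #>\<^bsub>?G\<^esub> tree_section k g x = K #>\<^bsub>?G\<^esub> tree_section k h x"
        if "x < k" for x
        using fun_cong[OF eq, of x] that by simp_all
      have "root_perm (g \<otimes>\<^bsub>?T\<^esub> inv\<^bsub>?T\<^esub> h) y = y \<and>
        tree_section k (g \<otimes>\<^bsub>?T\<^esub> inv\<^bsub>?T\<^esub> h) y \<in> K" if y: "y < k" for y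
      proof -
        define x where "x = root_perm (inv\<^bsub>?T\<^esub> h) y"
        have x: "x < k" unfolding x_def using root_perm_less y GT h by simp
        have hx: "root_perm h x = y"
          using root_perm_inv(1)[of "inv\<^bsub>?T\<^esub> h" k y] y GT h by (simp add: x_def)
        have s: "tree_section k g x \<in> G" "tree_section k h x \<in> G"
          using self_similar g h x by auto
        have "tree_section k g x \<in> K #>\<^bsub>?G\<^esub> tree_section k h x"
          using GG.rcos_self[OF _ N.subgroup_axioms] s coset[OF x] by auto
        then have "tree_section k g x \<otimes>\<^bsub>?T\<^esub> inv\<^bsub>?T\<^esub> (tree_section k h x) \<in> K"
          using N.rcos_module_imp[OF GG.is_group, of "tree_section k h x"] s inv_eq by simp
        moreover have "tree_section k (inv\<^bsub>?T\<^esub> h) y = inv\<^bsub>?T\<^esub> (tree_section k h x)"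
          using tree_section_inv[OF GT[OF h] x] hx by simp
        ultimately show ?thesis
          using GT g h y perm[OF x] hx by (simp add: root_perm_section_mult x_def[symmetric])
      qed
      then have "g \<otimes>\<^bsub>?T\<^esub> inv\<^bsub>?T\<^esub> h \<in> ?L"
        using GT g h by (simp add: first_level_power_def)
      then have "g \<in> ?L #>\<^bsub>?G\<^esub> h"
        using subgroup.rcos_module_rev[OF LG GG.is_group, of h g] g h inv_eq by simp
      then show ?thesis using GG.repr_independence[OF _ _ LG] h by simp
    qed
    ultimately have "finite ((\<lambda>g. ?L #>\<^bsub>?G\<^esub> g) ` G)"
      by (rule finite_image_if_determined)
    moreover have "rcosets\<^bsub>?G\<^esub> ?L = (\<lambda>g. ?L #>\<^bsub>?G\<^esub> g) ` G" by (auto simp: RCOSETS_def)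
    ultimately show ?thesis by simp
  qed
  ultimately show ?thesis by (simp add: finite_index_normal_def)
qed

section \<open>The Hanoi generators and contraction\<close>

lemma hanoi_gen_apply [simp]: "w \<in> words k \<Longrightarrow> hanoi_gen k i j w = swap_first i j w"
  by (simp add: hanoi_gen_def)

lemma hanoi_gen_square:
  assumes "i < k" "j < k"
  shows "hanoi_gen k i j \<otimes>\<^bsub>tree_group k\<^esub> hanoi_gen k i j = \<one>\<^bsub>tree_group k\<^esub>"
  by (rule tree_aut_eqI[where k = k])
    (use assms in \<open>auto simp: hanoi_gen_in_tree_aut swap_first_words swap_first_involution\<close>)

lemma hanoi_gens_square: "s \<in> hanoi_gens k \<Longrightarrow> s \<otimes>\<^bsub>tree_group k\<^esub> s = \<one>\<^bsub>tree_group k\<^esub>"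
  by (auto simp: hanoi_gens_def hanoi_gen_square)

lemma hanoi_gens_tree_aut: "s \<in> hanoi_gens k \<Longrightarrow> s \<in> tree_aut k"
  using hanoi_gens_in_carrier by auto

lemma hanoi_gens_inv: "s \<in> hanoi_gens k \<Longrightarrow> inv\<^bsub>tree_group k\<^esub> s = s"
  by (rule tree.inv_equality) (auto simp: hanoi_gens_square hanoi_gens_tree_aut)

lemma hanoi_gens_Un_inv: "hanoi_gens k \<union> m_inv (tree_group k) ` hanoi_gens k = hanoi_gens k"
  by (auto simp: hanoi_gens_inv)

lemma finite_hanoi_gens: "finite (hanoi_gens k)"
proof (rule finite_subset)
  show "hanoi_gens k \<subseteq> (\<lambda>(i, j). hanoi_gen k i j) ` ({..<k} \<times> {..<k})"
    by (force simp: hanoi_gens_def)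
qed simp

lemma hanoi_gens_3: "hanoi_gens 3 = {hanoi_gen 3 0 1, hanoi_gen 3 0 2, hanoi_gen 3 1 2}"
proof -
  have "i < j \<and> j < 3 \<longleftrightarrow> (i = 0 \<and> j = 1) \<or> (i = 0 \<and> j = 2) \<or> (i = 1 \<and> j = 2)" for i j :: nat
    by auto
  then show ?thesis by (simp only: hanoi_gens_def) blast
qed

lemma hanoi_gen_root_perm_section:
  assumes "i < k" "j < k" "x < k"
  shows "root_perm (hanoi_gen k i j) x = (if x = i then j else if x = j then i else x)"
    and "tree_section k (hanoi_gen k i j) x =
      (if x = i \<or> x = j then \<one>\<^bsub>tree_group k\<^esub> else hanoi_gen k i j)"
proof -
  let ?s = "if x = i \<or> x = j then \<one>\<^bsub>tree_group k\<^esub> else hanoi_gen k i j"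
  have "?s \<in> tree_aut k" using assms by (simp add: hanoi_gen_in_tree_aut)
  moreover have "hanoi_gen k i j (x # w) = (if x = i then j else if x = j then i else x) # ?s w"
    if "w \<in> words k" for w using assms that by simp
  ultimately show "root_perm (hanoi_gen k i j) x = (if x = i then j else if x = j then i else x)"
    and "tree_section k (hanoi_gen k i j) x = ?s"
    using root_perm_section_eqI[of ?s k "hanoi_gen k i j" x] by blast+
qed

lemma subgroup_hanoi_group: "subgroup (hanoi_group k) (tree_group k)"
  unfolding hanoi_group_def by (rule tree.generate_is_subgroup[OF hanoi_gens_in_carrier])

lemma hanoi_group_tree_aut: "g \<in> hanoi_group k \<Longrightarrow> g \<in> tree_aut k"
  using subgroup.subset[OF subgroup_hanoi_group] by auto

lemma hanoi_gens_hanoi_group: "s \<in> hanoi_gens k \<Longrightarrow> s \<in> hanoi_group k"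
  unfolding hanoi_group_def by (rule generate.incl)

lemma hanoi_gen_hanoi_group: "i < j \<Longrightarrow> j < k \<Longrightarrow> hanoi_gen k i j \<in> hanoi_group k"
  by (intro hanoi_gens_hanoi_group) (auto simp: hanoi_gens_def)

text \<open>A generator has section \<open>\<one>\<close> at the two pegs that it moves and section equal to itself at the pegs
  that it fixes. A word for the section therefore arises by deleting letters, and if no letter is
  deleted then every letter fixes \<open>x\<close>.\<close>

lemma section_word:
  assumes "set ws \<subseteq> hanoi_gens k" "x < k"
  shows "\<exists>vs. set vs \<subseteq> hanoi_gens k \<and>
    word_value (tree_group k) vs = tree_section k (word_value (tree_group k) ws) x \<and>
    length vs \<le> length ws \<and>
    (length vs = length ws \<longrightarrow>
      root_perm (word_value (tree_group k) ws) x = x \<and> (\<forall>s\<in>set ws. root_perm s x = x))"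
  using assms(1)
proof (induction ws)
  case Nil
  then show ?case using assms(2) by (intro exI[of _ "[]"]) (simp add: root_perm_section_one)
next
  case (Cons s ws)
  let ?g = "word_value (tree_group k) ws"
  have s: "s \<in> hanoi_gens k" and ws: "set ws \<subseteq> hanoi_gens k" using Cons.prems by auto
  obtain vs where vs: "set vs \<subseteq> hanoi_gens k" "word_value (tree_group k) vs = tree_section k ?g x"
    "length vs \<le> length ws"
    "length vs = length ws \<longrightarrow> root_perm ?g x = x \<and> (\<forall>s\<in>set ws. root_perm s x = x)"
    using Cons.IH[OF ws] by blast
  have g: "?g \<in> tree_aut k"
    using tree.word_value_closed[of ws k] ws hanoi_gens_in_carrier[of k] by auto
  note mult = root_perm_section_mult[OF hanoi_gens_tree_aut[OF s] g assms(2)]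
  have y: "root_perm ?g x < k" using root_perm_less[OF g assms(2)] .
  consider "root_perm s (root_perm ?g x) = root_perm ?g x" "tree_section k s (root_perm ?g x) = s"
    | "tree_section k s (root_perm ?g x) = \<one>\<^bsub>tree_group k\<^esub>"
  proof -
    obtain i j where ij: "i < j" "j < k" "s = hanoi_gen k i j"
      using s by (auto simp: hanoi_gens_def)
    show thesis
      using that hanoi_gen_root_perm_section[of i k j "root_perm ?g x"] ij y
      by (cases "root_perm ?g x = i \<or> root_perm ?g x = j") auto
  qed
  then show ?case
  proof cases
    case 1
    show ?thesis
      by (rule exI[of _ "s # vs"]) (use 1 s vs mult in auto)
  next
    case 2
    show ?thesis
      by (rule exI[of _ vs])
        (use 2 vs mult tree_section_in_tree_aut[OF g assms(2)] in auto)
  qed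
qed

lemma tree_section_hanoi_group:
  assumes g: "g \<in> hanoi_group k" and x: "x < k"
  shows "tree_section k g x \<in> hanoi_group k"
proof -
  obtain ws where ws: "set ws \<subseteq> hanoi_gens k" "word_value (tree_group k) ws = g"
    using tree.ex_word_value[OF hanoi_gens_in_carrier] g
    unfolding hanoi_group_def hanoi_gens_Un_inv by blast
  obtain vs where vs: "set vs \<subseteq> hanoi_gens k"
    "word_value (tree_group k) vs = tree_section k g x"
    using section_word[OF ws(1) x] ws(2) by blast
  show ?thesis
    using tree.word_value_mem_generate[of vs "hanoi_gens k" k] vs
    unfolding hanoi_group_def hanoi_gens_Un_inv by simp
qed

text \<open>This is special to three pegs: with four or more pegs, several generators fix a given peg.\<close>

lemma hanoi_gens_3_fixed_point_unique:
  assumes "s \<in> hanoi_gens 3" "t \<in> hanoi_gens 3" "x < 3" "root_perm s x = x" "root_perm t x = x"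
  shows "s = t"
proof -
  have "x = 0 \<or> x = 1 \<or> x = 2" using assms(3) by auto
  then show ?thesis
    using assms unfolding hanoi_gens_3 by (auto simp: hanoi_gen_root_perm_section)
qed

lemma contracting_hanoi_3: "contracting 3 (hanoi_gens 3)"
  unfolding contracting_def
proof (intro exI[of _ 2] ballI impI allI)
  let ?T = "tree_group 3" and ?S = "hanoi_gens 3"
  fix g x
  assume g: "g \<in> generate ?T ?S" and long: "2 \<le> word_length ?T ?S g" and x: "x < (3::nat)"
  obtain ws where ws: "set ws \<subseteq> ?S" "word_value ?T ws = g" "length ws = word_length ?T ?S g"
    using tree.ex_geodesic_word[OF hanoi_gens_in_carrier g] unfolding hanoi_gens_Un_inv by metis
  obtain vs where vs: "set vs \<subseteq> ?S" "word_value ?T vs = tree_section 3 g x"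
    "length vs \<le> length ws"
    "length vs = length ws \<longrightarrow> (\<forall>s\<in>set ws. root_perm s x = x)"
    using section_word[OF ws(1) x] ws(2) by blast
  have "length vs \<noteq> length ws"
  proof
    assume eq: "length vs = length ws"
    obtain s t us where us: "ws = s # t # us"
      using long ws(3) by (cases ws; cases "tl ws") auto
    \<comment> \<open>All letters fix \<open>x\<close>, so they coincide and the geodesic word could be shortened.\<close>
    have st: "s \<in> ?S" "t \<in> ?S" "set us \<subseteq> ?S" using ws(1) us by auto
    have "s = t"
      using hanoi_gens_3_fixed_point_unique[OF st(1,2) x] vs(4) eq us by auto
    moreover have "word_value ?T us \<in> tree_aut 3"
      using tree.word_value_closed[of us 3] st(3) hanoi_gens_in_carrier[of 3] by auto
    ultimately have "g = word_value ?T us"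
      using ws(2) us st hanoi_gens_square[OF st(1)]
      by (simp add: tree.m_assoc[symmetric] hanoi_gens_tree_aut)
    then have "word_length ?T ?S g \<le> length us"
      using word_length_le[of us ?S ?T] st(3) by auto
    then show False using ws(3) us by simp
  qed
  then have "word_length ?T ?S (tree_section 3 g x) < word_length ?T ?S g"
    using word_length_le[of vs ?S ?T] vs(1-3) ws(3) unfolding hanoi_gens_Un_inv by auto
  then show "tree_section 3 g x \<in> generate ?T ?S \<and>
      word_length ?T ?S (tree_section 3 g x) < word_length ?T ?S g"
    using tree_section_hanoi_group[of g 3 x] g x by (simp add: hanoi_group_def)
qed

section \<open>Spherical transitivity\<close>

text \<open>The group is self-replicating at the vertex \<open>0\<close>.\<close>

lemma hanoi_3_section_surj:
  assumes "h \<in> hanoi_group 3"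
  shows "\<exists>g\<in>hanoi_group 3. root_perm g 0 = 0 \<and> tree_section 3 g 0 = h"
proof -
  interpret H: subgroup "hanoi_group 3" "tree_group 3" by (rule subgroup_hanoi_group)
  let ?a = "hanoi_gen 3 0 1" and ?b = "hanoi_gen 3 0 2" and ?c = "hanoi_gen 3 1 2"
  have gens: "\<exists>g\<in>hanoi_group 3. root_perm g 0 = 0 \<and> tree_section 3 g 0 = s"
    if s: "s \<in> hanoi_gens 3" for s
  proof -
    note mem = hanoi_gen_hanoi_group[of _ _ 3] hanoi_gen_in_tree_aut[of _ 3]
    consider "s = ?a" | "s = ?b" | "s = ?c" using s unfolding hanoi_gens_3 by blast
    then show ?thesis
    proof cases
      case 1
      show ?thesis
        \<comment> \<open>\<open>b\<close> carries \<open>0\<close> to the peg \<open>2\<close>, which \<open>a\<close> fixes, and both letters \<open>b\<close> contribute \<open>\<one>\<close>.\<close>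
        by (rule bexI[of _ "?b \<otimes>\<^bsub>tree_group 3\<^esub> (?a \<otimes>\<^bsub>tree_group 3\<^esub> ?b)"])
          (use 1 mem in \<open>simp_all add: root_perm_section_mult hanoi_gen_root_perm_section\<close>)
    next
      case 2
      show ?thesis
        by (rule bexI[of _ "?a \<otimes>\<^bsub>tree_group 3\<^esub> (?b \<otimes>\<^bsub>tree_group 3\<^esub> ?a)"])
          (use 2 mem in \<open>simp_all add: root_perm_section_mult hanoi_gen_root_perm_section\<close>)
    next
      case 3
      show ?thesis
        by (rule bexI[of _ ?c]) (use 3 mem in \<open>simp_all add: hanoi_gen_root_perm_section\<close>)
    qed
  qed
  have "h \<in> generate (tree_group 3) (hanoi_gens 3)" using assms by (simp add: hanoi_group_def)
  then show ?thesis
  proof induction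
    case one
    then show ?case by (intro bexI[of _ "\<one>\<^bsub>tree_group 3\<^esub>"]) (simp_all add: root_perm_section_one)
  next
    case (incl s)
    then show ?case using gens by blast
  next
    case (inv s)
    then show ?case using gens by (simp add: hanoi_gens_inv)
  next
    case (eng h1 h2)
    then obtain g1 g2 where
      "g1 \<in> hanoi_group 3" "root_perm g1 0 = 0" "tree_section 3 g1 0 = h1"
      "g2 \<in> hanoi_group 3" "root_perm g2 0 = 0" "tree_section 3 g2 0 = h2" by blast
    then show ?case
      by (intro bexI[of _ "g1 \<otimes>\<^bsub>tree_group 3\<^esub> g2"])
        (simp_all add: root_perm_section_mult hanoi_group_tree_aut)
  qed
qed

lemma hanoi_3_orbit_zero:
  "u \<in> words 3 \<Longrightarrow> \<exists>g\<in>hanoi_group 3. g u = replicate (length u) 0"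
proof (induction u)
  case Nil
  interpret H: subgroup "hanoi_group 3" "tree_group 3" by (rule subgroup_hanoi_group)
  show ?case by (rule bexI[of _ "\<one>\<^bsub>tree_group 3\<^esub>"]) simp_all
next
  case (Cons x w)
  interpret H: subgroup "hanoi_group 3" "tree_group 3" by (rule subgroup_hanoi_group)
  have xw: "x < 3" "w \<in> words 3" using Cons.prems by auto
  then obtain h where h: "h \<in> hanoi_group 3" "h w = replicate (length w) 0"
    using Cons.IH by blast
  obtain g where g: "g \<in> hanoi_group 3" "root_perm g 0 = 0" "tree_section 3 g 0 = h"
    using hanoi_3_section_surj[OF h(1)] by blast
  \<comment> \<open>For \<open>x \<noteq> 0\<close>, the generator that swaps \<open>0\<close> and \<open>x\<close> leaves the remaining letters unchanged.\<close>
  have "\<exists>t\<in>hanoi_group 3. t (x # w) = 0 # w"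
  proof -
    consider "x = 0" | "x = 1" | "x = 2" using xw(1) by linarith
    then show ?thesis
    proof cases
      case 1
      then show ?thesis using xw by (intro bexI[of _ "\<one>\<^bsub>tree_group 3\<^esub>"]) simp_all
    next
      case 2
      then show ?thesis
        using xw by (intro bexI[of _ "hanoi_gen 3 0 1"]) (simp_all add: hanoi_gen_hanoi_group)
    next
      case 3
      then show ?thesis
        using xw by (intro bexI[of _ "hanoi_gen 3 0 2"]) (simp_all add: hanoi_gen_hanoi_group)
    qed
  qed
  then obtain t where t: "t \<in> hanoi_group 3" "t (x # w) = 0 # w" by blast
  have "(g \<otimes>\<^bsub>tree_group 3\<^esub> t) (x # w) = g (0 # w)"
    using g(1) t xw by (simp add: hanoi_group_tree_aut)
  also have "\<dots> = replicate (length (x # w)) 0"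
    using tree_aut_decomp[of g 3 0 w] g h(2) xw(2) by (simp add: hanoi_group_tree_aut)
  finally show ?case using H.m_closed[OF g(1) t(1)] by blast
qed

lemma spherically_transitive_hanoi_3: "spherically_transitive 3 (hanoi_group 3)"
  unfolding spherically_transitive_def
proof (intro ballI impI)
  interpret H: subgroup "hanoi_group 3" "tree_group 3" by (rule subgroup_hanoi_group)
  fix u v assume u: "u \<in> words 3" and v: "v \<in> words 3" and len: "length u = length v"
  obtain g where g: "g \<in> hanoi_group 3" "g u = replicate (length u) 0"
    using hanoi_3_orbit_zero[OF u] by blast
  obtain h where h: "h \<in> hanoi_group 3" "h v = replicate (length v) 0"
    using hanoi_3_orbit_zero[OF v] by blast
  let ?h' = "inv\<^bsub>tree_group 3\<^esub> h"
  have "(?h' \<otimes>\<^bsub>tree_group 3\<^esub> g) u = ?h' (h v)"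
    using g h u len by (simp add: hanoi_group_tree_aut)
  also have "\<dots> = v" by (rule tree_inv_apply(2)[OF hanoi_group_tree_aut[OF h(1)] v])
  finally show "\<exists>g\<in>hanoi_group 3. g u = v"
    using H.m_closed[OF H.m_inv_closed[OF h(1)] g(1)] by blast
qed

section \<open>The commutator subgroup\<close>

text \<open>The commutator subgroup of the Hanoi Towers group on \<open>k\<close> pegs.\<close>

abbreviation hanoi_commutator :: "nat \<Rightarrow> (nat list \<Rightarrow> nat list) set" where
  "hanoi_commutator k \<equiv> derived (tree_group k) (hanoi_group k)"

lemma
  shows hanoi_square_mem_commutator:
      "g \<in> hanoi_group k \<Longrightarrow> g \<otimes>\<^bsub>tree_group k\<^esub> g \<in> hanoi_commutator k"
    and finite_index_normal_hanoi_commutator: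
      "finite_index_normal (tree_group k) (hanoi_commutator k) (hanoi_group k)"
proof -
  let ?H = "tree_group k\<lparr>carrier := hanoi_group k\<rparr>"
  interpret H: group ?H
    by (rule subgroup.subgroup_is_group[OF subgroup_hanoi_group tree.is_group])
  have S: "hanoi_gens k \<subseteq> carrier ?H" by (auto simp: hanoi_gens_hanoi_group)
  have gen: "generate ?H (hanoi_gens k) = carrier ?H"
    using tree.generate_consistent[OF _ subgroup_hanoi_group, of "hanoi_gens k" k] S
    by (simp add: hanoi_group_def)
  have invol: "s \<otimes>\<^bsub>?H\<^esub> s = \<one>\<^bsub>?H\<^esub>" if "s \<in> hanoi_gens k" for s
    using hanoi_gens_square[OF that] by simp
  have der: "derived ?H (carrier ?H) = hanoi_commutator k"
    using tree.derived_consistent[OF _ subgroup_hanoi_group] by simp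
  show "g \<otimes>\<^bsub>tree_group k\<^esub> g \<in> hanoi_commutator k" if "g \<in> hanoi_group k"
    using H.square_mem_derived[OF S gen invol] that der by simp
  show "finite_index_normal (tree_group k) (hanoi_commutator k) (hanoi_group k)"
    using H.finite_rcosets_derived[OF S gen invol finite_hanoi_gens] der
      tree.derived_subgroup_is_normal[OF subgroup_hanoi_group]
    by (simp add: finite_index_normal_def)
qed

lemma subgroup_hanoi_commutator: "subgroup (hanoi_commutator k) (tree_group k)"
  by (rule tree.derived_is_subgroup) (auto simp: hanoi_group_tree_aut)

lemma hanoi_commutator_subset: "hanoi_commutator k \<subseteq> hanoi_group k"
  by (rule tree.derived_incl[OF _ subgroup_hanoi_group]) simp

lemma hanoi_commutator_conj:
  assumes "g \<in> hanoi_group k" "h \<in> hanoi_commutator k"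
  shows "g \<otimes>\<^bsub>tree_group k\<^esub> h \<otimes>\<^bsub>tree_group k\<^esub> inv\<^bsub>tree_group k\<^esub> g \<in> hanoi_commutator k"
  using normal.inv_op_closed2[OF tree.derived_subgroup_is_normal[OF subgroup_hanoi_group], of g k h]
    tree.m_inv_consistent[OF subgroup_hanoi_group] assms by simp

text \<open>Up to symmetry there is one identity, \<open>([b,c],1,1) = (abac)\<^sup>2\<close>: the element \<open>abac\<close> has
  trivial root permutation and sections \<open>(bc,a,a)\<close>, and \<open>a\<close> is an involution.
  Exchanging the pegs 1 and 2 gives \<open>(babc)\<^sup>2\<close>. Exchanging 0 and 2 gives \<open>(cbca)\<^sup>2\<close>, which is \<open>[b,a]\<close> at the vertex \<open>2\<close>; its conjugate by \<open>b\<close> is \<open>(bcbcab)\<^sup>2\<close>.\<close>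

lemma lift_at_hanoi_commutators:
  assumes "s \<in> hanoi_gens 3" "t \<in> hanoi_gens 3"
  shows "\<exists>g\<in>hanoi_group 3. lift_at 3 0
      (s \<otimes>\<^bsub>tree_group 3\<^esub> t \<otimes>\<^bsub>tree_group 3\<^esub> inv\<^bsub>tree_group 3\<^esub> s \<otimes>\<^bsub>tree_group 3\<^esub> inv\<^bsub>tree_group 3\<^esub> t)
    = g \<otimes>\<^bsub>tree_group 3\<^esub> g"
proof -
  interpret H: subgroup "hanoi_group 3" "tree_group 3" by (rule subgroup_hanoi_group)
  let ?a = "hanoi_gen 3 0 1" and ?b = "hanoi_gen 3 0 2" and ?c = "hanoi_gen 3 1 2"
  let ?P = "\<lambda>s t. \<exists>g\<in>hanoi_group 3.
    lift_at 3 0 (s \<otimes>\<^bsub>tree_group 3\<^esub> t \<otimes>\<^bsub>tree_group 3\<^esub> s \<otimes>\<^bsub>tree_group 3\<^esub> t) = g \<otimes>\<^bsub>tree_group 3\<^esub> g"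
  note mem = hanoi_gen_hanoi_group[of _ _ 3] hanoi_gen_in_tree_aut[of _ 3]
  have letter: "x = 0 \<or> x = 1 \<or> x = 2" if "x < 3" for x :: nat using that by auto
  have bc: "?P ?b ?c"
    by (rule bexI[of _ "word_value (tree_group 3) [?a, ?b, ?a, ?c]"], rule tree_aut_eqI[where k = 3])
      (auto dest!: letter simp: mem swap_first_words swap_first_involution)
  have ac: "?P ?a ?c"
    by (rule bexI[of _ "word_value (tree_group 3) [?b, ?a, ?b, ?c]"], rule tree_aut_eqI[where k = 3])
      (auto dest!: letter simp: mem swap_first_words swap_first_involution)
  have ba: "?P ?b ?a"
    by (rule bexI[of _ "word_value (tree_group 3) [?b, ?c, ?b, ?c, ?a, ?b]"], rule tree_aut_eqI[where k = 3])
      (auto dest!: letter simp: mem swap_first_words swap_first_involution)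
  have sym: "?P t s" if P: "?P s t" and st: "s \<in> hanoi_gens 3" "t \<in> hanoi_gens 3" for s t
  proof -
    obtain g where g: "g \<in> hanoi_group 3"
      "lift_at 3 0 (s \<otimes>\<^bsub>tree_group 3\<^esub> t \<otimes>\<^bsub>tree_group 3\<^esub> s \<otimes>\<^bsub>tree_group 3\<^esub> t) = g \<otimes>\<^bsub>tree_group 3\<^esub> g"
      using P by blast
    note aut = st[THEN hanoi_gens_tree_aut] hanoi_group_tree_aut[OF g(1)]
    have "t \<otimes>\<^bsub>tree_group 3\<^esub> s \<otimes>\<^bsub>tree_group 3\<^esub> t \<otimes>\<^bsub>tree_group 3\<^esub> s =
        inv\<^bsub>tree_group 3\<^esub> (s \<otimes>\<^bsub>tree_group 3\<^esub> t \<otimes>\<^bsub>tree_group 3\<^esub> s \<otimes>\<^bsub>tree_group 3\<^esub> t)"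
      using aut by (simp add: tree.inv_mult_group st[THEN hanoi_gens_inv] tree.m_assoc)
    then have "lift_at 3 0 (t \<otimes>\<^bsub>tree_group 3\<^esub> s \<otimes>\<^bsub>tree_group 3\<^esub> t \<otimes>\<^bsub>tree_group 3\<^esub> s) =
        inv\<^bsub>tree_group 3\<^esub> (g \<otimes>\<^bsub>tree_group 3\<^esub> g)"
      using aut g(2) by (simp add: lift_at_inv)
    also have "\<dots> = inv\<^bsub>tree_group 3\<^esub> g \<otimes>\<^bsub>tree_group 3\<^esub> inv\<^bsub>tree_group 3\<^esub> g"
      using aut by (simp add: tree.inv_mult_group)
    finally show ?thesis using H.m_inv_closed[OF g(1)] by blast
  qed
  have refl: "?P s s" if "s \<in> hanoi_gens 3" for s
    by (rule bexI[of _ "\<one>\<^bsub>tree_group 3\<^esub>"])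
      (use that in \<open>simp_all add: hanoi_gens_square hanoi_gens_tree_aut tree.m_assoc lift_at_one\<close>)
  have gens: "?a \<in> hanoi_gens 3" "?b \<in> hanoi_gens 3" "?c \<in> hanoi_gens 3"
    unfolding hanoi_gens_3 by blast+
  have "s = ?a \<or> s = ?b \<or> s = ?c" "t = ?a \<or> t = ?b \<or> t = ?c"
    using assms unfolding hanoi_gens_3 by simp_all
  then have "?P s t"
    by (elim disjE; hypsubst)
      (rule refl[OF gens(1)] refl[OF gens(2)] refl[OF gens(3)] bc ac ba
        sym[OF bc gens(2,3)] sym[OF ac gens(1,3)] sym[OF ba gens(2,1)])+
  then show ?thesis using assms by (simp add: hanoi_gens_inv)
qed

lemma lift_at_zero_mem_hanoi_commutator:
  assumes "u \<in> hanoi_commutator 3"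
  shows "lift_at 3 0 u \<in> hanoi_commutator 3"
proof -
  let ?T = "tree_group 3" and ?D = "hanoi_commutator 3"
  let ?H = "?T\<lparr>carrier := hanoi_group 3\<rparr>"
  \<comment> \<open>\<open>N\<close> is normal since the stabiliser of the vertex \<open>0\<close> induces all of \<open>H\<close> below it, and the
    generators commute modulo \<open>N\<close>.\<close>
  define N where "N = {u \<in> hanoi_group 3. lift_at 3 0 u \<in> ?D}"
  interpret H: subgroup "hanoi_group 3" ?T by (rule subgroup_hanoi_group)
  interpret D: subgroup ?D ?T by (rule subgroup_hanoi_commutator)
  interpret HG: group ?H by (rule H.subgroup_is_group[OF tree.is_group])
  have inv_eq: "inv\<^bsub>?H\<^esub> g = inv\<^bsub>?T\<^esub> g" if "g \<in> hanoi_group 3" for g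
    using tree.m_inv_consistent[OF subgroup_hanoi_group that] .
  have "subgroup N ?H"
  proof (rule HG.subgroupI)
    have "\<one>\<^bsub>?T\<^esub> \<in> N" by (simp add: N_def lift_at_one)
    then show "N \<noteq> {}" by blast
  qed (auto simp: N_def inv_eq lift_at_inv lift_at_mult hanoi_group_tree_aut)
  then have "N \<lhd> ?H"
  proof (rule HG.normal_invI)
    fix h u assume "h \<in> carrier ?H" and u: "u \<in> N"
    then have h: "h \<in> hanoi_group 3" by simp
    obtain g where g: "g \<in> hanoi_group 3" "root_perm g 0 = 0" "tree_section 3 g 0 = h"
      using hanoi_3_section_surj[OF h] by blast
    have uH: "u \<in> hanoi_group 3" "lift_at 3 0 u \<in> ?D" using u by (auto simp: N_def)
    have "lift_at 3 0 (h \<otimes>\<^bsub>?T\<^esub> u \<otimes>\<^bsub>?T\<^esub> inv\<^bsub>?T\<^esub> h) \<in> ?D"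
      using conj_lift_at[of g 3 u 0] hanoi_commutator_conj[OF g(1) uH(2)] g uH(1)
      by (simp add: hanoi_group_tree_aut)
    then show "h \<otimes>\<^bsub>?H\<^esub> u \<otimes>\<^bsub>?H\<^esub> inv\<^bsub>?H\<^esub> h \<in> N"
      using h uH(1) by (simp add: N_def inv_eq)
  qed
  then interpret N: normal N ?H .
  have gens: "hanoi_gens 3 \<subseteq> carrier ?H" by (auto simp: hanoi_gens_hanoi_group)
  have "derived ?H (carrier ?H) \<subseteq> N"
  proof (rule N.derived_subset_if_generators_commute[OF gens])
    show "generate ?H (hanoi_gens 3) = carrier ?H"
      using tree.generate_consistent[OF _ subgroup_hanoi_group, of "hanoi_gens 3" 3] gens
      by (simp add: hanoi_group_def)
    fix s t assume st: "s \<in> hanoi_gens 3" "t \<in> hanoi_gens 3"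
    then have sH: "s \<in> hanoi_group 3" "t \<in> hanoi_group 3" by (simp_all add: hanoi_gens_hanoi_group)
    obtain g where "g \<in> hanoi_group 3" "lift_at 3 0
        (s \<otimes>\<^bsub>?T\<^esub> t \<otimes>\<^bsub>?T\<^esub> inv\<^bsub>?T\<^esub> s \<otimes>\<^bsub>?T\<^esub> inv\<^bsub>?T\<^esub> t) = g \<otimes>\<^bsub>?T\<^esub> g"
      using lift_at_hanoi_commutators[OF st] by blast
    then have "lift_at 3 0 (s \<otimes>\<^bsub>?T\<^esub> t \<otimes>\<^bsub>?T\<^esub> inv\<^bsub>?T\<^esub> s \<otimes>\<^bsub>?T\<^esub> inv\<^bsub>?T\<^esub> t) \<in> ?D"
      using hanoi_square_mem_commutator by metis
    then show "s \<otimes>\<^bsub>?H\<^esub> t \<otimes>\<^bsub>?H\<^esub> inv\<^bsub>?H\<^esub> s \<otimes>\<^bsub>?H\<^esub> inv\<^bsub>?H\<^esub> t \<in> N"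
      using sH by (simp add: N_def inv_eq)
  qed
  then have "?D \<subseteq> N"
    using tree.derived_consistent[OF _ subgroup_hanoi_group, of "hanoi_group 3" 3] by simp
  then show ?thesis using assms by (auto simp: N_def)
qed

lemma lift_at_mem_hanoi_commutator:
  assumes u: "u \<in> hanoi_commutator 3" and i: "i < 3"
  shows "lift_at 3 i u \<in> hanoi_commutator 3"
proof (cases "i = 0")
  case True
  then show ?thesis using lift_at_zero_mem_hanoi_commutator[OF u] by simp
next
  case False
  let ?s = "hanoi_gen 3 0 i"
  have s: "?s \<in> hanoi_group 3" "?s \<in> tree_aut 3"
    using False i by (simp_all add: hanoi_gen_hanoi_group hanoi_gen_in_tree_aut)
  have uT: "u \<in> tree_aut 3"
    using u hanoi_commutator_subset hanoi_group_tree_aut by blast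
  have "lift_at 3 i u = ?s \<otimes>\<^bsub>tree_group 3\<^esub> lift_at 3 0 u \<otimes>\<^bsub>tree_group 3\<^esub> inv\<^bsub>tree_group 3\<^esub> ?s"
    using conj_lift_at[OF s(2) uT, of 0] hanoi_gen_root_perm_section[of 0 3 i 0] i uT by simp
  then show ?thesis
    using hanoi_commutator_conj[OF s(1) lift_at_zero_mem_hanoi_commutator[OF u]] by simp
qed

lemma first_level_power_subset_hanoi_commutator:
  "first_level_power 3 (hanoi_commutator 3) \<subseteq> hanoi_commutator 3"
proof
  let ?T = "tree_group 3"
  interpret D: subgroup "hanoi_commutator 3" ?T by (rule subgroup_hanoi_commutator)
  fix g assume g: "g \<in> first_level_power 3 (hanoi_commutator 3)"
  note gD = first_level_power_memD[OF g]
  let ?l = "\<lambda>i. lift_at 3 i (tree_section 3 g i)"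
  have sec: "tree_section 3 g x \<in> tree_aut 3" if "x < 3" for x
    using tree_section_in_tree_aut[OF gD(1) that] .
  have "g = ?l 0 \<otimes>\<^bsub>?T\<^esub> (?l 1 \<otimes>\<^bsub>?T\<^esub> ?l 2)"
  proof (rule tree_aut_eqI[where k = 3])
    fix x w assume xw: "x < (3::nat)" "(w :: nat list) \<in> words 3"
    then have "x = 0 \<or> x = 1 \<or> x = 2" by auto
    then show "g (x # w) = (?l 0 \<otimes>\<^bsub>?T\<^esub> (?l 1 \<otimes>\<^bsub>?T\<^esub> ?l 2)) (x # w)"
      using xw gD(1,2) sec tree_aut_decomp[OF gD(1) xw]
      by (auto simp: tree_section_words)
  qed (use gD sec in auto)
  also have "\<dots> \<in> hanoi_commutator 3"
    using gD(3) by (simp add: lift_at_mem_hanoi_commutator)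
  finally show "g \<in> hanoi_commutator 3" .
qed



theorem theorem1p1:
  shows "contracting 3 (hanoi_gens 3) \<and>
         regularly_branching 3 (hanoi_group 3) (derived (tree_group 3) (hanoi_group 3))"
proof
  show "contracting 3 (hanoi_gens 3)" by (rule contracting_hanoi_3)
  have "finite_index_normal (tree_group 3) (first_level_power 3 (hanoi_commutator 3)) (hanoi_group 3)"
    using first_level_power_subset_hanoi_commutator hanoi_commutator_subset
    by (intro finite_index_normal_first_level_power subgroup_hanoi_group tree_section_hanoi_group
        finite_index_normal_hanoi_commutator) blast+
  then show "regularly_branching 3 (hanoi_group 3) (hanoi_commutator 3)"
    unfolding regularly_branching_def
    using subgroup_hanoi_group spherically_transitive_hanoi_3
      finite_index_normal_hanoi_commutator first_level_power_subset_hanoi_commutator by blast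
qed

end
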